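(* There exists a convex body $K\subset\mathbb{R}^3$ with non-empty interior such that all the complex roots of the relative Steiner polynomial $f(B_3,K,s)=\sum_{i=0}^3\binom{3}{i}\mathrm{W}_i(B_3;K)\,s^i$ have real part less than $-\mathrm{r}(B_3;K)$.
   Context: A convex body is a compact convex set in $\mathbb{R}^n$; $B_n$ is the Euclidean unit ball of $\mathbb{R}^n$. For convex bodies $K,E\subset\mathbb{R}^n$, the relative quermassintegrals $\mathrm{W}_i(K;E)$, $0\le i\le n$, are the coefficients defined by $\mathrm{V}(K+\rho E)=\sum_{i=0}^n\binom{n}{i}\mathrm{W}_i(K;E)\rho^i$ for all $\rho\ge0$, where $\mathrm{V}$ is $n$-dimensional Lebesgue measure. The relative Steiner polynomial $f(K,E,s)=\sum_{i=0}^n\binom{n}{i}\mathrm{W}_i(K;E)s^i$ is regarded as a polynomial in the complex variable $s$. The relative inradius is $\mathrm{r}(K;E)=\max\{r:\exists\,x\in\mathbb{R}^n\text{ with }x+rE\subseteq K\}$. *)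

theory Defs
  imports "HOL-Analysis.Analysis" "HOL-Computational_Algebra.Polynomial" "HOL-Library.Set_Algebras"
begin

definition convex_body :: "'a::euclidean_space set \<Rightarrow> bool" where
  "convex_body K \<longleftrightarrow> compact K \<and> convex K"

definition is_steiner_expansion ::
    "'a::euclidean_space set \<Rightarrow> 'a set \<Rightarrow> (nat \<Rightarrow> real) \<Rightarrow> bool" where
  "is_steiner_expansion K E W \<longleftrightarrow>
     (\<forall>\<rho>\<ge>0. measure lebesgue (K + (*\<^sub>R) \<rho> ` E) =
        (\<Sum>i\<le>DIM('a). real (DIM('a) choose i) * W i * \<rho> ^ i))"

text \<open>The expansion only involves the indices up to the dimension; the value 0 beyond it is a
  convention that makes the sequence of coefficients unique. For nonempty convex bodies existence is
  Minkowski's theorem on mixed volumes; in all other cases the value may be unspecified.\<close>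

definition quermassintegral ::
    "'a::euclidean_space set \<Rightarrow> 'a set \<Rightarrow> nat \<Rightarrow> real" where
  "quermassintegral K E =
     (THE W. is_steiner_expansion K E W \<and> (\<forall>i>DIM('a). W i = 0))"

definition steiner_poly :: "'a::euclidean_space set \<Rightarrow> 'a set \<Rightarrow> complex poly" where
  "steiner_poly K E =
     (\<Sum>i\<le>DIM('a). monom (of_nat (DIM('a) choose i) * of_real (quermassintegral K E i)) i)"

text \<open>The maximum is attained whenever K is compact and nonempty and E has at least two points.\<close>

definition relative_inradius ::
    "'a::euclidean_space set \<Rightarrow> 'a set \<Rightarrow> real" where
  "relative_inradius K E = (GREATEST r. \<exists>x. (\<lambda>y. x + r *\<^sub>R y) ` E \<subseteq> K)"

lemma steiner_expansion_unique:
  fixes K E :: "'a::euclidean_space set"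
  assumes "is_steiner_expansion K E W" "is_steiner_expansion K E W'" "i \<le> DIM('a)"
  shows "W i = W' i"
proof -
  define c where "c j = real (DIM('a) choose j) * (W j - W' j)" for j
  define p where "p = (\<Sum>j\<le>DIM('a). monom (c j) j)"
  have "poly p \<rho> = 0" if "\<rho> \<ge> 0" for \<rho>
  proof -
    have "(\<Sum>j\<le>DIM('a). real (DIM('a) choose j) * W j * \<rho> ^ j) =
          (\<Sum>j\<le>DIM('a). real (DIM('a) choose j) * W' j * \<rho> ^ j)"
      using assms(1,2) that unfolding is_steiner_expansion_def by metis
    then show ?thesis
      by (simp add: p_def c_def poly_sum poly_monom algebra_simps sum_subtractf)
  qed
  then have "{0..} \<subseteq> {\<rho>. poly p \<rho> = 0}" by auto
  then have "p = 0"
    using poly_roots_finite[of p] infinite_Ici[of "0::real"] finite_subset by blast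
  moreover have "coeff p i = c i"
    using assms(3) by (simp add: p_def coeff_sum)
  ultimately show ?thesis
    using assms(3) by (simp add: c_def)
qed

lemma quermassintegral_eqI:
  fixes K E :: "'a::euclidean_space set"
  assumes "is_steiner_expansion K E W" "i \<le> DIM('a)"
  shows "quermassintegral K E i = W i"
proof -
  define W0 where "W0 j = (if j \<le> DIM('a) then W j else 0)" for j
  have exp: "is_steiner_expansion K E W0"
    using assms(1) unfolding is_steiner_expansion_def
    by (auto simp: W0_def intro!: sum.cong)
  have "quermassintegral K E = W0"
    unfolding quermassintegral_def
  proof (rule the_equality)
    show "is_steiner_expansion K E W0 \<and> (\<forall>i>DIM('a). W0 i = 0)"
      using exp by (simp add: W0_def)
  next
    fix V assume V: "is_steiner_expansion K E V \<and> (\<forall>i>DIM('a). V i = 0)"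
    show "V = W0"
    proof
      fix j show "V j = W0 j"
        using steiner_expansion_unique[OF conjunct1[OF V] exp] V
        by (cases "j \<le> DIM('a)") (auto simp: W0_def)
    qed
  qed
  then show ?thesis using assms(2) by (simp add: W0_def)
qed

end

theory Submission imports Defs begin

text \<open>
  Let \<open>L\<close> be a planar lens, the intersection of two unit discs with opening angle \<open>\<theta>\<close> and circumradius
  \<open>sin \<theta>\<close>, and let \<open>K = L + B\<^sub>3\<close>. Then \<open>B\<^sub>3 + \<rho> K = \<rho> L + (1 + \<rho>) B\<^sub>3\<close>, whose horizontal slices are planar
  parallel bodies of \<open>\<rho> L\<close>; integrating their areas gives
  \<open>f(s) = \<sigma> s\<^sup>2 (1 + s) + M s (1 + s)\<^sup>2 + \<kappa> (1 + s)\<^sup>3\<close> with \<open>\<kappa> = 4\<pi>/3\<close>, \<open>M = 2\<pi>\<theta>\<close> and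
  \<open>\<sigma> = 4(\<theta> - sin \<theta> cos \<theta>)\<close>. One root is \<open>-1\<close>, and the relative inradius is \<open>r = 1/(1 + sin \<theta>) < 1\<close>.
  By the Hurwitz criterion the two other roots lie to the left of \<open>-r\<close> as soon as
  \<open>(M + 2\<kappa>)(1 + sin \<theta>) > 2(\<sigma> + M + \<kappa>)\<close> and \<open>\<kappa> sin\<^sup>2 \<theta> - M sin \<theta> + \<sigma> > 0\<close>. The first condition
  fails for the disc, \<open>\<theta> = \<pi>/2\<close>, and the second for \<open>\<theta> = \<pi>/3\<close>, but \<open>\<theta> = 3\<pi>/8\<close> satisfies both.
\<close>

subsection \<open>Parallel bodies of a planar lens\<close>

text \<open>The upper boundary of the planar parallel body \<open>a L + t B\<^sub>2\<close>, where \<open>L\<close> is the intersection of the unit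
  discs centred at \<open>(0, c)\<close> and \<open>(0, - c)\<close>, with tips \<open>(s, 0)\<close> and \<open>(- s, 0)\<close>: an arc of radius
  \<open>a + t\<close>, continued on both sides by arcs of radius \<open>t\<close> around the scaled tips.\<close>

definition lens_height :: "real \<Rightarrow> real \<Rightarrow> real \<Rightarrow> real \<Rightarrow> real \<Rightarrow> real" where
  "lens_height s c a t x =
     (if \<bar>x\<bar> \<le> (a + t) * s then sqrt ((a + t)\<^sup>2 - x\<^sup>2) - a * c
      else sqrt (t\<^sup>2 - (\<bar>x\<bar> - a * s)\<^sup>2))"

text \<open>The left-hand side is membership of \<open>(x, y)\<close> in a L + t B_2. The bounds on
  \<open>x\<close> and \<open>y\<close> come from the tip, from the triangle inequality at the
  centre of the upper arc and, beyond that arc, from the normal cone at the tip. Conversely, a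
  suitable point of a L is explicit: the point itself, its radial projection to the upper arc, or
  the tip.\<close>

lemma lens_parallel_quadrant:
  fixes s c a t x y :: real
  assumes "s > 0" "c > 0" and sc: "s\<^sup>2 + c\<^sup>2 = 1" and at: "a \<ge> 0" "t \<ge> 0" and xy: "x \<ge> 0" "y \<ge> 0"
  shows "(\<exists>u v. u\<^sup>2 + (\<bar>v\<bar> + c)\<^sup>2 \<le> 1 \<and> (x - a * u)\<^sup>2 + (y - a * v)\<^sup>2 \<le> t\<^sup>2) \<longleftrightarrow>
           x \<le> a * s + t \<and> y \<le> lens_height s c a t x" (is "?L \<longleftrightarrow> ?R")
proof
  assume ?L
  then obtain u v where uv: "u\<^sup>2 + (\<bar>v\<bar> + c)\<^sup>2 \<le> 1" and d: "(x - a * u)\<^sup>2 + (y - a * v)\<^sup>2 \<le> t\<^sup>2"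
    by blast
  have "c\<^sup>2 \<le> (\<bar>v\<bar> + c)\<^sup>2" using \<open>c > 0\<close> by (intro power_mono) auto
  then have "u\<^sup>2 \<le> s\<^sup>2" using uv sc by linarith
  then have us: "u \<le> s" using \<open>s > 0\<close> by (simp add: abs_le_square_iff[symmetric])
  have "(x - a * u)\<^sup>2 \<le> t\<^sup>2" using d zero_le_power2[of "y - a * v"] by linarith
  then have "x - a * u \<le> t" using at by (simp add: abs_le_square_iff[symmetric])
  then have xt: "x \<le> a * s + t" using mult_left_mono[OF us \<open>a \<ge> 0\<close>] by linarith
  have "(v + c)\<^sup>2 \<le> (\<bar>v\<bar> + c)\<^sup>2" using \<open>c > 0\<close> by (intro power2_le_iff_abs_le[THEN iffD2]) auto
  then have uv': "u\<^sup>2 + (v + c)\<^sup>2 \<le> 1" using uv by linarith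
  \<comment> \<open>Distances are taken from \<open>(0, - a * c)\<close>, the centre of the upper
    arc of the scaled lens: points of a L are within \<open>a\<close> of it, and the disc adds
    \<open>t\<close>.\<close>
  have "sqrt (x\<^sup>2 + (y + a * c)\<^sup>2) = sqrt ((a * u + (x - a * u))\<^sup>2 + (a * (v + c) + (y - a * v))\<^sup>2)"
    by (simp add: algebra_simps)
  also have "\<dots> \<le> sqrt ((a * u)\<^sup>2 + (a * (v + c))\<^sup>2) + sqrt ((x - a * u)\<^sup>2 + (y - a * v)\<^sup>2)"
    by (rule real_sqrt_sum_squares_triangle_ineq)
  also have "\<dots> \<le> a + t"
  proof (rule add_mono)
    have "(a * u)\<^sup>2 + (a * (v + c))\<^sup>2 = a\<^sup>2 * (u\<^sup>2 + (v + c)\<^sup>2)"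
      by (simp add: power_mult_distrib distrib_left[of _ "u\<^sup>2"])
    also have "\<dots> \<le> a\<^sup>2" using uv' mult_left_mono[OF uv', of "a\<^sup>2"] by simp
    finally show "sqrt ((a * u)\<^sup>2 + (a * (v + c))\<^sup>2) \<le> a" using at by (simp add: real_le_lsqrt)
    show "sqrt ((x - a * u)\<^sup>2 + (y - a * v)\<^sup>2) \<le> t" using d at by (simp add: real_le_lsqrt)
  qed
  finally have "x\<^sup>2 + (y + a * c)\<^sup>2 \<le> (a + t)\<^sup>2" by (rule sqrt_le_D)
  then have y: "y \<le> sqrt ((a + t)\<^sup>2 - x\<^sup>2) - a * c"
    using real_le_rsqrt[of "y + a * c" "(a + t)\<^sup>2 - x\<^sup>2"] by linarith
  \<comment> \<open>Past the end of the large arc, its bound still gives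
    \<open>y \<le> t * c\<close>. Together with \<open>x - a * s \<ge> t * s\<close> this limits the
    slope of the displacement from the scaled tip, which makes the tip the nearest point of the
    lens.\<close>
  have "y \<le> sqrt (t\<^sup>2 - (x - a * s)\<^sup>2)" if far: "x > (a + t) * s"
  proof -
    have w: "x - a * s \<ge> t * s" using far by (simp add: algebra_simps)
    have w0: "x - a * s \<ge> 0" using w at \<open>s > 0\<close> by (meson mult_nonneg_nonneg less_imp_le order_trans)
    have "((a + t) * s)\<^sup>2 \<le> x\<^sup>2" using far at \<open>s > 0\<close> by (intro power_mono) auto
    moreover have "((a + t) * s)\<^sup>2 + ((a + t) * c)\<^sup>2 = (a + t)\<^sup>2"
      unfolding power_mult_distrib distrib_left[symmetric] sc by simp
    ultimately have "(a + t)\<^sup>2 - x\<^sup>2 \<le> ((a + t) * c)\<^sup>2" by linarith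
    then have "sqrt ((a + t)\<^sup>2 - x\<^sup>2) \<le> (a + t) * c" using at \<open>c > 0\<close> by (intro real_le_lsqrt) auto
    then have "y \<le> t * c" using y by (simp add: algebra_simps)
    then have "y * s \<le> t * c * s" using \<open>s > 0\<close> by simp
    also have "\<dots> \<le> c * (x - a * s)" using mult_left_mono[OF w, of c] \<open>c > 0\<close> by (simp add: algebra_simps)
    finally have ys: "y * s \<le> c * (x - a * s)" .
    \<comment> \<open>The displacement \<open>(x - a s, y)\<close> lies in the normal cone of the lens at its tip \<open>(s, 0)\<close>.\<close>
    have "(x - a * s) * (u - s) + y * v \<le> 0"
    proof (cases "v \<le> 0")
      case True
      then show ?thesis using mult_nonneg_nonpos[OF w0, of "u - s"] mult_nonneg_nonpos[OF \<open>y \<ge> 0\<close>, of v] us by linarith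
    next
      case False
      \<comment> \<open>Cauchy-Schwarz for \<open>(u, v + c)\<close> and \<open>(s, c)\<close>, both
        in the unit disc.\<close>
      have "u * s + (v + c) * c \<le> 1"
        using uv' sc sum_squares_bound[of u s] sum_squares_bound[of "v + c" c] by linarith
      then have k: "u * s + v * c - s\<^sup>2 \<le> 0" using sc by (simp add: power2_eq_square algebra_simps)
      have "s * ((x - a * s) * (u - s) + y * v) \<le> (x - a * s) * (u * s + v * c - s\<^sup>2)"
        using mult_right_mono[OF ys, of v] False by (simp add: power2_eq_square algebra_simps)
      also have "\<dots> \<le> 0" using k w0 by (simp add: mult_nonneg_nonpos)
      finally show ?thesis using \<open>s > 0\<close> by (simp add: mult_le_0_iff)
    qed
    then have m: "a * ((x - a * s) * (u - s) + y * v) \<le> 0" using at by (simp add: mult_nonneg_nonpos)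
    \<comment> \<open>Law of cosines at the scaled tip: by \<open>m\<close> the angle is not acute,
      so the tip is at least as close as \<open>(a * u, a * v)\<close>.\<close>
    have "(x - a * u)\<^sup>2 + (y - a * v)\<^sup>2 = (x - a * s)\<^sup>2 + y\<^sup>2 - 2 * (a * ((x - a * s) * (u - s) + y * v))
          + (a * (u - s))\<^sup>2 + (a * v)\<^sup>2"
      by (simp add: power2_eq_square algebra_simps)
    then have "(x - a * s)\<^sup>2 + y\<^sup>2 \<le> t\<^sup>2"
      using d m zero_le_power2[of "a * (u - s)"] zero_le_power2[of "a * v"] by linarith
    then show ?thesis by (intro real_le_rsqrt) linarith
  qed
  then show ?R using xt y xy by (auto simp: lens_height_def)
next
  assume r: ?R
  have tip: ?L if "(x - a * s)\<^sup>2 + y\<^sup>2 \<le> t\<^sup>2"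
    using that sc by (intro exI[of _ s] exI[of _ 0]) simp
  show ?L
  proof (cases "x \<le> (a + t) * s")
    case near: True
    then have y: "y + a * c \<le> sqrt ((a + t)\<^sup>2 - x\<^sup>2)" using r xy by (simp add: lens_height_def)
    have "x\<^sup>2 + (y + a * c)\<^sup>2 \<le> (a + t)\<^sup>2"
    proof -
      have "0 \<le> y + a * c" using xy at \<open>c > 0\<close> by simp
      then have "(y + a * c)\<^sup>2 \<le> (sqrt ((a + t)\<^sup>2 - x\<^sup>2))\<^sup>2" using y by (rule power_mono[rotated])
      \<comment> \<open>The real \<open>sqrt\<close> is odd, so a nonnegative value forces a
        nonnegative radicand.\<close>
      moreover have "0 \<le> (a + t)\<^sup>2 - x\<^sup>2"
        using y \<open>0 \<le> y + a * c\<close> by (metis order_trans real_sqrt_ge_0_iff)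
      ultimately show ?thesis by simp
    qed
    then have r': "sqrt (x\<^sup>2 + (y + a * c)\<^sup>2) \<le> a + t" using at by (intro real_le_lsqrt) auto
    define R where "R = sqrt (x\<^sup>2 + (y + a * c)\<^sup>2)"
    have R2: "R\<^sup>2 = x\<^sup>2 + (y + a * c)\<^sup>2" and R0: "R \<ge> 0" by (auto simp: R_def)
    show ?thesis
    \<comment> \<open>Seen from the arc centre \<open>(0, - a * c)\<close>, the tip lies in
      direction \<open>(s, c)\<close>; the cases ask whether the point lies in the sector spanned by
      the upper arc.\<close>
    proof (cases "c * x \<le> s * (y + a * c)")
      case arc: True
      show ?thesis
      proof (cases "R \<le> a")
        case True
        show ?thesis
        proof (cases "a = 0")
          case True
          with \<open>R \<le> a\<close> R0 R2 xy have "x = 0" "y = 0" by (auto simp: sum_power2_eq_zero_iff)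
          moreover have "c\<^sup>2 \<le> 1" using sc zero_le_power2[of s] by linarith
          ultimately show ?thesis using at by (intro exI[of _ 0]) auto
        next
          case False
          then have "a > 0" using at by simp
          have "(x / a)\<^sup>2 + (y / a + c)\<^sup>2 = R\<^sup>2 / a\<^sup>2" using \<open>a > 0\<close> R2
            by (simp add: field_simps power2_eq_square)
          also have "\<dots> \<le> 1" using True R0 \<open>a > 0\<close> by (simp add: power_mono)
          finally show ?thesis using \<open>a > 0\<close> xy
            by (intro exI[of _ "x / a"] exI[of _ "y / a"]) simp
        qed
      next
        case False
        then have "R > 0" using at by linarith
        \<comment> \<open>The witness is the radial projection to the unit circle about
          \<open>(0, - c)\<close>. The sector condition makes its second coordinate nonnegative, so
          the absolute value in the lens condition disappears.\<close>
        have "(c * R)\<^sup>2 = (c * x)\<^sup>2 + c\<^sup>2 * (y + a * c)\<^sup>2" by (simp add: R2 power_mult_distrib algebra_simps)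
        also have "\<dots> \<le> (s * (y + a * c))\<^sup>2 + c\<^sup>2 * (y + a * c)\<^sup>2"
          using arc xy \<open>c > 0\<close> by (intro add_mono power_mono) auto
        also have "\<dots> = (s\<^sup>2 + c\<^sup>2) * (y + a * c)\<^sup>2" by (simp only: power_mult_distrib distrib_right)
        finally have "(c * R)\<^sup>2 \<le> (y + a * c)\<^sup>2" using sc by simp
        then have "c * R \<le> y + a * c" using xy at \<open>c > 0\<close> by (auto intro: power2_le_imp_le)
        then have v0: "(y + a * c) / R - c \<ge> 0" using \<open>R > 0\<close> by (simp add: field_simps)
        have 1: "(x / R)\<^sup>2 + ((y + a * c) / R)\<^sup>2 = 1"
          using \<open>R > 0\<close> by (simp add: power_divide add_divide_distrib[symmetric] R2[symmetric])
        have "(x - a * (x / R))\<^sup>2 + (y - a * ((y + a * c) / R - c))\<^sup>2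
            = (R - a)\<^sup>2 * ((x / R)\<^sup>2 + ((y + a * c) / R)\<^sup>2)"
          using \<open>R > 0\<close> by (simp add: field_simps power2_eq_square)
        also have "\<dots> \<le> t\<^sup>2" unfolding 1 using False r' by (simp add: R_def power_mono)
        finally show ?thesis using v0 1
          by (intro exI[of _ "x / R"] exI[of _ "(y + a * c) / R - c"]) simp
      qed
    next
      case False
      \<comment> \<open>Outside the sector the displacement from the tip is flatter than
        \<open>(s, c)\<close> and its horizontal part is at most \<open>t * s\<close>, so its length
        is at most \<open>t\<close>.\<close>
      have "0 \<le> s * y" using xy \<open>s > 0\<close> by simp
      then have yc: "s * y < c * (x - a * s)" using False by (simp add: algebra_simps)
      then have "0 \<le> x - a * s" using \<open>0 \<le> s * y\<close> \<open>c > 0\<close>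
        by (metis less_le_trans linorder_not_le mult_pos_neg order_less_asym)
      moreover have xs: "x - a * s \<le> t * s" using near by (simp add: algebra_simps)
      ultimately have 1: "(x - a * s)\<^sup>2 \<le> (t * s)\<^sup>2" by (intro power_mono)
      have "s * y \<le> s * (t * c)" using yc mult_left_mono[OF xs, of c] \<open>c > 0\<close> by (simp add: algebra_simps)
      then have "y \<le> t * c" using \<open>s > 0\<close> by simp
      then have "y\<^sup>2 \<le> (t * c)\<^sup>2" using xy by (intro power_mono)
      with 1 have "(x - a * s)\<^sup>2 + y\<^sup>2 \<le> t\<^sup>2 * (s\<^sup>2 + c\<^sup>2)" by (simp add: power_mult_distrib algebra_simps)
      then show ?thesis using tip sc by simp
    qed
  next
    case False
    then have y: "y \<le> sqrt (t\<^sup>2 - (x - a * s)\<^sup>2)" and x: "x \<le> a * s + t"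
      using r xy by (auto simp: lens_height_def)
    have "0 \<le> t * s" using at \<open>s > 0\<close> by simp
    then have "0 \<le> x - a * s" using False by (simp add: algebra_simps)
    then have "(x - a * s)\<^sup>2 \<le> t\<^sup>2" using x by (intro power_mono) auto
    moreover have "y\<^sup>2 \<le> (sqrt (t\<^sup>2 - (x - a * s)\<^sup>2))\<^sup>2" using y xy by (intro power_mono)
    ultimately show ?thesis using tip by simp
  qed
qed

text \<open>Both sides are invariant under reflection in the coordinate axes, so the first quadrant
  suffices.\<close>

lemma lens_parallel_iff:
  fixes s c a t x y :: real
  assumes "s > 0" "c > 0" "s\<^sup>2 + c\<^sup>2 = 1" "a \<ge> 0" "t \<ge> 0"
  shows "(\<exists>u v. u\<^sup>2 + (\<bar>v\<bar> + c)\<^sup>2 \<le> 1 \<and> (x - a * u)\<^sup>2 + (y - a * v)\<^sup>2 \<le> t\<^sup>2) \<longleftrightarrow>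
           \<bar>x\<bar> \<le> a * s + t \<and> \<bar>y\<bar> \<le> lens_height s c a t x"
proof -
  have sgn: "(\<bar>x\<bar> - a * (if x < 0 then - u else u))\<^sup>2 = (x - a * u)\<^sup>2" for x u :: real
    by (simp add: abs_if power2_eq_square algebra_simps)
  have "(\<exists>u v. u\<^sup>2 + (\<bar>v\<bar> + c)\<^sup>2 \<le> 1 \<and> (x - a * u)\<^sup>2 + (y - a * v)\<^sup>2 \<le> t\<^sup>2) \<longleftrightarrow>
        (\<exists>u v. u\<^sup>2 + (\<bar>v\<bar> + c)\<^sup>2 \<le> 1 \<and> (\<bar>x\<bar> - a * u)\<^sup>2 + (\<bar>y\<bar> - a * v)\<^sup>2 \<le> t\<^sup>2)"
    (is "(\<exists>u v. ?P u v) \<longleftrightarrow> (\<exists>u v. ?Q u v)")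
  proof -
    have 1: "?P u v \<longleftrightarrow> ?Q (if x < 0 then - u else u) (if y < 0 then - v else v)" for u v
      unfolding sgn by simp
    have 2: "?Q u v \<longleftrightarrow> ?P (if x < 0 then - u else u) (if y < 0 then - v else v)" for u v
      unfolding 1 by (cases "x < 0"; cases "y < 0"; simp)
    show ?thesis using 1 2 by blast
  qed
  then show ?thesis
    using lens_parallel_quadrant[OF assms, of "\<bar>x\<bar>" "\<bar>y\<bar>"] by (simp add: lens_height_def)
qed

section \<open>Areas of the planar parallel bodies\<close>

text \<open>\<open>F\<close> is the usual antiderivative of a semicircle of radius \<open>R\<close>
  centred at \<open>m\<close>. It need not be differentiable at the ends of the diameter, hence the
  interior form of the fundamental theorem. The case \<open>R = 0\<close> forces
  \<open>p = q\<close> and serves degenerate bodies.\<close>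

lemma has_integral_circle:
  fixes R m p q :: real
  assumes "m - R \<le> p" "p \<le> q" "q \<le> m + R"
  defines "F \<equiv> \<lambda>x. ((x - m) * sqrt (R\<^sup>2 - (x - m)\<^sup>2) + R\<^sup>2 * arcsin ((x - m) / R)) / 2"
  shows "((\<lambda>x. sqrt (R\<^sup>2 - (x - m)\<^sup>2)) has_integral F q - F p) {p..q}"
proof (cases "R = 0")
  case True
  then have "p = q" using assms by linarith
  then show ?thesis by (simp add: has_integral_refl)
next
  case False
  then have "R > 0" using assms by linarith
  show ?thesis
  proof (rule fundamental_theorem_of_calculus_interior)
    show "p \<le> q" by fact
    show "continuous_on {p..q} F"
      unfolding F_def using assms \<open>R > 0\<close> by (intro continuous_intros) (auto simp: field_simps)
    fix x assume x: "x \<in> {p<..<q}"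
    then have "\<bar>x - m\<bar> < R" using assms by (simp add: abs_less_iff)
    then have "(x - m)\<^sup>2 < R\<^sup>2"
      using power_strict_mono[of "\<bar>x - m\<bar>" R 2] by simp
    then have pos: "R\<^sup>2 - (x - m)\<^sup>2 > 0" by simp
    define w where "w = sqrt (R\<^sup>2 - (x - m)\<^sup>2)"
    have w: "w > 0" "w * w = R\<^sup>2 - (x - m)\<^sup>2" using pos by (auto simp: w_def)
    have e: "sqrt (1 - ((x - m) / R)\<^sup>2) = w / R"
    proof -
      have "1 - ((x - m) / R)\<^sup>2 = (R\<^sup>2 - (x - m)\<^sup>2) / R\<^sup>2"
        using \<open>R > 0\<close> by (simp add: field_simps)
      then show ?thesis using \<open>R > 0\<close> by (simp add: w_def real_sqrt_divide)
    qed
    have 1: "((\<lambda>x. sqrt (R\<^sup>2 - (x - m)\<^sup>2)) has_real_derivative - (x - m) / w) (at x)"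
      using pos by (auto intro!: derivative_eq_intros simp: w_def field_simps)
    have "(arcsin has_real_derivative inverse (w / R)) (at ((x - m) / R))"
      unfolding e[symmetric] using assms x \<open>R > 0\<close> by (intro DERIV_arcsin) (auto simp: field_simps)
    moreover have "((\<lambda>x. (x - m) / R) has_real_derivative 1 / R) (at x)"
      using \<open>R > 0\<close> by (auto intro!: derivative_eq_intros)
    ultimately have 2: "((\<lambda>x. arcsin ((x - m) / R)) has_real_derivative inverse (w / R) * (1 / R)) (at x)"
      by (rule DERIV_chain2)
    have 3: "((\<lambda>x. x - m) has_real_derivative 1) (at x)"
      by (auto intro!: derivative_eq_intros)
    have "(F has_real_derivative
        (1 * sqrt (R\<^sup>2 - (x - m)\<^sup>2) + - (x - m) / w * (x - m) + R\<^sup>2 * (inverse (w / R) * (1 / R))) / 2) (at x)"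
      unfolding F_def by (intro DERIV_cdivide DERIV_add DERIV_mult DERIV_cmult 1 2 3)
    moreover have "(1 * sqrt (R\<^sup>2 - (x - m)\<^sup>2) + - (x - m) / w * (x - m) + R\<^sup>2 * (inverse (w / R) * (1 / R))) / 2 = w"
    proof -
      \<comment> \<open>Multiplication by \<open>w\<close> clears denominators and leaves only
        \<open>w * w = R\<^sup>2 - (x - m)\<^sup>2\<close>.\<close>
      have "(w + - (x - m) / w * (x - m) + R\<^sup>2 * (inverse (w / R) * (1 / R))) * w = w * w - (x - m)\<^sup>2 + R\<^sup>2"
      proof -
        have "- d / w * d * w = - d\<^sup>2" for d
          using w(1) by (simp add: power2_eq_square)
        then have "- (x - m) / w * (x - m) * w = - (x - m)\<^sup>2" .
        moreover have "R\<^sup>2 * (inverse (w / R) * (1 / R)) * w = R\<^sup>2"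
          using w(1) \<open>R > 0\<close> by simp
        ultimately show ?thesis unfolding distrib_right by linarith
      qed
      also have "\<dots> = (2 * w) * w" using w(2) by simp
      finally show ?thesis using w(1) by (simp add: w_def)
    qed
    ultimately have "(F has_real_derivative w) (at x)" by (rule back_subst)
    then show "(F has_vector_derivative sqrt (R\<^sup>2 - (x - m)\<^sup>2)) (at x)"
      by (simp add: has_real_derivative_iff_has_vector_derivative w_def)
  qed
qed


text \<open>A quarter of the parallel body, computed as two circular pieces that meet at
  \<open>x = (a + t) * sin \<theta>\<close>.\<close>

lemma has_integral_lens_height:
  fixes a t \<theta> :: real
  assumes \<theta>: "0 < \<theta>" "\<theta> < pi / 2" and at: "a \<ge> 0" "t \<ge> 0"
  shows "(lens_height (sin \<theta>) (cos \<theta>) a t has_integral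
           a\<^sup>2 * (\<theta> - sin \<theta> * cos \<theta>) / 2 + a * t * \<theta> + t\<^sup>2 * pi / 4) {0..a * sin \<theta> + t}"
proof -
  define s c where "s = sin \<theta>" and "c = cos \<theta>"
  have s: "0 < s" "s \<le> 1" and c: "0 < c" and sc: "1 - s\<^sup>2 = c\<^sup>2"
    using \<theta> by (auto simp: s_def c_def sin_gt_zero2 cos_gt_zero cos_squared_eq)
  have arcsin: "arcsin s = \<theta>" using \<theta> by (simp add: s_def arcsin_sin)
  have root: "sqrt (r\<^sup>2 - (r * s)\<^sup>2) = r * c" if "r \<ge> 0" for r
  proof -
    have "r\<^sup>2 - (r * s)\<^sup>2 = r\<^sup>2 * (1 - s\<^sup>2)" by (simp add: power_mult_distrib algebra_simps)
    then show ?thesis using that c by (simp add: sc real_sqrt_mult)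
  qed
  \<comment> \<open>For \<open>r = 0\<close> the quotient is 0 by convention and the factor
    \<open>r\<^sup>2\<close> kills the term, so vanishing radii need no separate treatment.\<close>
  have as: "r\<^sup>2 * arcsin (r * s / r) = r\<^sup>2 * \<theta>" for r
    by (cases "r = 0") (auto simp: arcsin)
  have as1: "r\<^sup>2 * arcsin (r / r) = r\<^sup>2 * (pi / 2)" for r :: real
    by (cases "r = 0") auto
  define R where "R = a + t"
  have R: "R \<ge> 0" "R * s \<ge> 0" "t * s \<ge> 0" "t * s \<le> t" "R * s \<le> R" using at s by (auto simp: R_def mult_left_le)
  have "((\<lambda>x. sqrt (R\<^sup>2 - (x - 0)\<^sup>2)) has_integral
      ((R * s - 0) * sqrt (R\<^sup>2 - (R * s - 0)\<^sup>2) + R\<^sup>2 * arcsin ((R * s - 0) / R)) / 2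
      - ((0 - 0) * sqrt (R\<^sup>2 - (0 - 0)\<^sup>2) + R\<^sup>2 * arcsin ((0 - 0) / R)) / 2) {0..R * s}"
    using R by (intro has_integral_circle) auto
  then have "((\<lambda>x. sqrt (R\<^sup>2 - x\<^sup>2)) has_integral R\<^sup>2 * (s * c + \<theta>) / 2) {0..R * s}"
    unfolding diff_zero as root[OF R(1)] by (simp add: algebra_simps power2_eq_square)
  from has_integral_diff[OF this has_integral_const_real[of "a * c" 0 "R * s"]]
  have "((\<lambda>x. sqrt (R\<^sup>2 - x\<^sup>2) - a * c) has_integral R\<^sup>2 * (s * c + \<theta>) / 2 - R * s * (a * c)) {0..R * s}"
    using R by simp
  then have 1: "(lens_height s c a t has_integral R\<^sup>2 * (s * c + \<theta>) / 2 - R * s * (a * c)) {0..R * s}"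
    by (rule has_integral_eq[rotated]) (auto simp: lens_height_def R_def)
  have Rs: "R * s - a * s = t * s" by (simp add: R_def algebra_simps)
  have "((\<lambda>x. sqrt (t\<^sup>2 - (x - a * s)\<^sup>2)) has_integral
      ((a * s + t - a * s) * sqrt (t\<^sup>2 - (a * s + t - a * s)\<^sup>2) + t\<^sup>2 * arcsin ((a * s + t - a * s) / t)) / 2
      - ((R * s - a * s) * sqrt (t\<^sup>2 - (R * s - a * s)\<^sup>2) + t\<^sup>2 * arcsin ((R * s - a * s) / t)) / 2) {R * s..a * s + t}"
    using R Rs at by (intro has_integral_circle) auto
  then have "((\<lambda>x. sqrt (t\<^sup>2 - (x - a * s)\<^sup>2)) has_integral t\<^sup>2 * (pi / 2 - s * c - \<theta>) / 2) {R * s..a * s + t}"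
    unfolding Rs add_diff_cancel_left' as as1 root[OF at(2)]
    by (rule back_subst[where P = "\<lambda>i. (_ has_integral i) _"]) (simp add: field_simps power2_eq_square)
  then have 2: "(lens_height s c a t has_integral t\<^sup>2 * (pi / 2 - s * c - \<theta>) / 2) {R * s..a * s + t}"
    \<comment> \<open>At \<open>R * s\<close> itself the definition takes the first branch; this
      single point is negligible.\<close>
    by (rule has_integral_spike_finite[of "{R * s}", rotated 2]) (use R in \<open>auto simp: lens_height_def R_def\<close>)
  have "R * s \<le> a * s + t" using Rs R by linarith
  from has_integral_combine[OF R(2) this 1 2]
  show ?thesis unfolding s_def[symmetric] c_def[symmetric]
    by (rule back_subst[where P = "\<lambda>i. (_ has_integral i) _"])
       (simp add: R_def field_simps power2_eq_square)
qed

lemma lens_height_nonneg: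
  fixes s c a t x :: real
  assumes "s > 0" "c > 0" and sc: "s\<^sup>2 + c\<^sup>2 = 1" and at: "a \<ge> 0" "t \<ge> 0" and x: "\<bar>x\<bar> \<le> a * s + t"
  shows "lens_height s c a t x \<ge> 0"
proof (cases "\<bar>x\<bar> \<le> (a + t) * s")
  case True
  then have "x\<^sup>2 \<le> ((a + t) * s)\<^sup>2" using power_mono[of "\<bar>x\<bar>" _ 2] by simp
  moreover have "((a + t) * s)\<^sup>2 + ((a + t) * c)\<^sup>2 = (a + t)\<^sup>2"
    unfolding power_mult_distrib distrib_left[symmetric] sc by simp
  ultimately have "((a + t) * c)\<^sup>2 \<le> (a + t)\<^sup>2 - x\<^sup>2" by linarith
  then have "(a + t) * c \<le> sqrt ((a + t)\<^sup>2 - x\<^sup>2)" by (rule real_le_rsqrt)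
  moreover have "a * c \<le> (a + t) * c" using at \<open>c > 0\<close> by simp
  ultimately show ?thesis using True by (simp add: lens_height_def)
next
  case False
  have "0 \<le> t * s" using at \<open>s > 0\<close> by simp
  then have "0 \<le> \<bar>x\<bar> - a * s" using False by (simp add: algebra_simps)
  then have "(\<bar>x\<bar> - a * s)\<^sup>2 \<le> t\<^sup>2" using x by (intro power_mono) auto
  then show ?thesis using False by (simp add: lens_height_def)
qed

text \<open>This is the planar Steiner formula for L, with area
  \<open>2 * (\<theta> - sin \<theta> * cos \<theta>)\<close> and perimeter
  \<open>4 * \<theta>\<close>. Symmetry in both axes reduces it to one quarter.\<close>

lemma lens_parallel_area:
  fixes a t \<theta> :: real
  assumes \<theta>: "0 < \<theta>" "\<theta> < pi / 2" and at: "a \<ge> 0" "t \<ge> 0"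
  shows "(\<integral>\<^sup>+x. emeasure lborel {y. \<bar>x\<bar> \<le> a * sin \<theta> + t \<and> \<bar>y\<bar> \<le> lens_height (sin \<theta>) (cos \<theta>) a t x} \<partial>lborel)
      = ennreal (2 * a\<^sup>2 * (\<theta> - sin \<theta> * cos \<theta>) + 4 * a * t * \<theta> + t\<^sup>2 * pi)"
    (is "_ = ennreal ?A")
proof -
  define s c where "s = sin \<theta>" and "c = cos \<theta>"
  have s: "0 < s" and c: "0 < c" and sc: "s\<^sup>2 + c\<^sup>2 = 1"
    using \<theta> by (auto simp: s_def c_def sin_gt_zero2 cos_gt_zero)
  define b where "b = a * s + t"
  have b: "b \<ge> 0" using s at by (simp add: b_def)
  let ?h = "lens_height s c a t"
  have r: "(?h has_integral ?A / 4) {0..b}"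
    using has_integral_lens_height[OF assms] unfolding s_def c_def b_def
    by (rule back_subst[where P = "\<lambda>i. (_ has_integral i) _"]) (simp add: field_simps)
  have "?h (- x) = ?h x" for x by (simp add: lens_height_def)
  then have l: "(?h has_integral ?A / 4) {-b..0}"
    using has_integral_reflect_real[of ?h "?A / 4" b 0] r by simp
  from has_integral_combine[OF _ _ l r] b
  have "(?h has_integral ?A / 4 + ?A / 4) {-b..b}" by simp
  moreover have "2 * (X / 4 + X / 4) = X" for X :: real by simp
  ultimately have int: "((\<lambda>x. 2 * ?h x) has_integral ?A) {-b..b}"
    using has_integral_mult_right[of ?h "?A / 4 + ?A / 4" "{-b..b}" 2] by metis
  have nonneg: "?h x \<ge> 0" if "x \<in> {-b..b}" for x
    using that by (intro lens_height_nonneg[OF s c sc at]) (auto simp: b_def)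
  have "emeasure lborel {y. \<bar>x\<bar> \<le> b \<and> \<bar>y\<bar> \<le> ?h x} = ennreal (2 * ?h x) * indicator {-b..b} x" for x
  proof (cases "x \<in> {-b..b}")
    case True
    then have "{y. \<bar>x\<bar> \<le> b \<and> \<bar>y\<bar> \<le> ?h x} = {- ?h x..?h x}" by (auto simp: abs_le_iff)
    then show ?thesis using True nonneg[OF True] by simp
  next
    case False
    then have e: "{y. \<bar>x\<bar> \<le> b \<and> \<bar>y\<bar> \<le> ?h x} = {}" by (auto simp: abs_le_iff)
    show ?thesis unfolding e using False by simp
  qed
  then show ?thesis
    using nn_integral_has_integral_lebesgue'[OF _ int] nonneg by (simp add: s_def c_def b_def)
qed

subsection \<open>Parallel bodies of the lens in space\<close>

lemma emeasure_lborel_Times: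
  fixes A :: "'a::euclidean_space set" and B :: "'b::euclidean_space set"
  assumes "A \<in> sets borel" "B \<in> sets borel"
  shows "emeasure lborel (A \<times> B) = emeasure lborel A * emeasure lborel B"
  unfolding lborel_prod[symmetric] using assms by (intro lborel.emeasure_pair_measure_Times) auto

text \<open>Cavalieri's principle. The coordinate map \<open>T\<close> carries product Lebesgue
  measure to \<open>lborel\<close>, which is determined by its values on boxes; Tonelli then
  applies. The variable \<open>z\<close> is outermost because the slices used later are
  horizontal.\<close>

lemma emeasure_lborel_vec3:
  fixes S :: "(real ^ 3) set"
  assumes S: "S \<in> sets borel"
  shows "emeasure lborel S =
    (\<integral>\<^sup>+z. \<integral>\<^sup>+x. emeasure lborel {y. vector [x, y, z] \<in> S} \<partial>lborel \<partial>lborel)"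
proof -
  define T :: "real \<times> real \<times> real \<Rightarrow> real ^ 3" where "T = (\<lambda>(z, x, y). vector [x, y, z])"
  have T': "T = (\<lambda>p. \<chi> i. if i = 1 then fst (snd p) else if i = 2 then snd (snd p) else fst p)"
    by (auto simp: T_def fun_eq_iff vec_eq_iff forall_3 vector_3)
  have "continuous_on UNIV T"
    unfolding T'
  proof (rule continuous_on_vec_lambda)
    show "continuous_on UNIV (\<lambda>p. if i = 1 then fst (snd p) else if i = 2 then snd (snd p) else fst p)"
      for i :: 3
      by (cases "i = 1"; cases "i = 2") (auto intro!: continuous_intros)
  qed
  then have T[measurable]: "T \<in> borel_measurable borel"
    by (rule borel_measurable_continuous_onI)
  have distr: "lborel = distr lborel borel T"
  proof (rule lborel_eqI)
    fix l u :: "real ^ 3"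
    assume le: "\<And>b. b \<in> Basis \<Longrightarrow> l \<bullet> b \<le> u \<bullet> b"
    have lu: "l $ i \<le> u $ i" for i
      using le[of "axis i 1"] by (simp add: inner_axis axis_in_Basis_iff)
    have "T -` box l u = {l $ 3 <..< u $ 3} \<times> {l $ 1 <..< u $ 1} \<times> {l $ 2 <..< u $ 2}"
      by (auto simp: T_def mem_box_cart forall_3 vector_3)
    then have "emeasure (distr lborel borel T) (box l u) =
        emeasure lborel ({l $ 3 <..< u $ 3} \<times> {l $ 1 <..< u $ 1} \<times> {l $ 2 <..< u $ 2})"
      by (simp add: emeasure_distr)
    also have "\<dots> = ennreal (u $ 3 - l $ 3) * (ennreal (u $ 1 - l $ 1) * ennreal (u $ 2 - l $ 2))"
      using lu by (simp add: emeasure_lborel_Times borel_Times)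
    also have "\<dots> = ennreal (\<Prod>b\<in>Basis. (u - l) \<bullet> b)"
    proof -
      have "(\<Prod>b\<in>Basis. (u - l) \<bullet> b) = (\<Prod>i\<in>UNIV. u $ i - l $ i)"
        unfolding Basis_vec_def
        by (subst prod.UNION_disjoint) (auto simp: inner_axis axis_eq_axis)
      also have "\<dots> = (u $ 3 - l $ 3) * ((u $ 1 - l $ 1) * (u $ 2 - l $ 2))"
        unfolding UNIV_3 by (simp add: mult_ac)
      finally show ?thesis using lu by (simp add: ennreal_mult)
    qed
    finally show "emeasure (distr lborel borel T) (box l u) = ennreal (\<Prod>b\<in>Basis. (u - l) \<bullet> b)" .
  qed simp
  have TS: "T -` S \<in> sets (lborel \<Otimes>\<^sub>M (lborel \<Otimes>\<^sub>M lborel))"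
    unfolding lborel_prod using measurable_sets[OF T S] by simp
  have "emeasure lborel S = emeasure (distr lborel borel T) S"
    by (rule arg_cong[OF distr])
  also have "\<dots> = emeasure (lborel \<Otimes>\<^sub>M (lborel \<Otimes>\<^sub>M lborel)) (T -` S)"
    unfolding lborel_prod using S by (simp add: emeasure_distr)
  also have "\<dots> = (\<integral>\<^sup>+z. emeasure (lborel \<Otimes>\<^sub>M lborel) (Pair z -` (T -` S)) \<partial>lborel)"
  proof (rule sigma_finite_measure.emeasure_pair_measure_alt[OF _ TS])
    show "sigma_finite_measure (lborel \<Otimes>\<^sub>M lborel :: (real \<times> real) measure)"
      unfolding lborel_prod by (rule lborel.sigma_finite_measure_axioms)
  qed
  also have "\<dots> = (\<integral>\<^sup>+z. \<integral>\<^sup>+x. emeasure lborel (Pair x -` (Pair z -` (T -` S))) \<partial>lborel \<partial>lborel)"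
    by (intro nn_integral_cong lborel.emeasure_pair_measure_alt) (rule sets_Pair1[OF TS])
  moreover have "Pair x -` (Pair z -` (T -` S)) = {y. vector [x, y, z] \<in> S}" for x z
    by (auto simp: T_def)
  ultimately show ?thesis by simp
qed

section \<open>The lens in 3-space and the volume of its parallel bodies\<close>

lemma compact_set_plus:
  fixes S T :: "'a::real_normed_vector set"
  assumes "compact S" "compact T"
  shows "compact (S + T)"
proof -
  have "S + T = {x + y | x y. x \<in> S \<and> y \<in> T}" by (auto simp: set_plus_def)
  then show ?thesis using compact_sums[OF assms] by simp
qed

lemma norm_vec3_le_iff:
  fixes p :: "real ^ 3"
  assumes "r \<ge> 0"
  shows "norm p \<le> r \<longleftrightarrow> (p $ 1)\<^sup>2 + (p $ 2)\<^sup>2 + (p $ 3)\<^sup>2 \<le> r\<^sup>2"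
proof -
  have "norm p \<le> r \<longleftrightarrow> (norm p)\<^sup>2 \<le> r\<^sup>2"
    using assms by (metis norm_ge_zero power_mono power2_le_imp_le)
  moreover have "(norm p)\<^sup>2 = (p $ 1)\<^sup>2 + (p $ 2)\<^sup>2 + (p $ 3)\<^sup>2"
    unfolding power2_norm_eq_inner inner_vec_def sum_3 by (simp add: power2_eq_square)
  ultimately show ?thesis by simp
qed

text \<open>For \<open>c \<ge> 0\<close> the absolute value selects the farther of the two disc
  centres, so one inequality encodes both discs.\<close>

definition flat_lens :: "real \<Rightarrow> (real ^ 3) set" where
  "flat_lens c = {q. q $ 3 = 0 \<and> (q $ 1)\<^sup>2 + (\<bar>q $ 2\<bar> + c)\<^sup>2 \<le> 1}"

text \<open>Compactness and convexity can be read off from this form.\<close>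

lemma flat_lens_eq:
  assumes "c \<ge> 0"
  shows "flat_lens c = cball (vector [0, c, 0]) 1 \<inter> cball (vector [0, - c, 0]) 1 \<inter> {q. q $ 3 = 0}"
proof -
  have "u + (\<bar>v\<bar> + c)\<^sup>2 \<le> 1 \<longleftrightarrow> u + (c - v)\<^sup>2 \<le> 1 \<and> u + (- c - v)\<^sup>2 \<le> 1" for u v
  proof -
    have e: "(c - v)\<^sup>2 = c\<^sup>2 + v\<^sup>2 - 2 * (c * v)" "(- c - v)\<^sup>2 = c\<^sup>2 + v\<^sup>2 + 2 * (c * v)"
      "(\<bar>v\<bar> + c)\<^sup>2 = c\<^sup>2 + v\<^sup>2 + 2 * (c * \<bar>v\<bar>)"
      by (simp_all add: power2_eq_square algebra_simps)
    have "c * \<bar>v\<bar> = \<bar>c * v\<bar>" using assms by (simp add: abs_mult)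
    then show ?thesis unfolding e by linarith
  qed
  then show ?thesis
    by (auto simp: flat_lens_def dist_norm norm_vec3_le_iff vector_3)
qed

lemma compact_flat_lens: "c \<ge> 0 \<Longrightarrow> compact (flat_lens c)"
  unfolding flat_lens_eq
  by (intro compact_Int_closed compact_cball closed_cball closed_Collect_eq continuous_intros)

lemma convex_flat_lens: "c \<ge> 0 \<Longrightarrow> convex (flat_lens c)"
  unfolding flat_lens_eq
  by (intro convex_Int convex_cball) (auto simp: convex_def)

lemma zero_in_flat_lens: "\<bar>c\<bar> \<le> 1 \<Longrightarrow> 0 \<in> flat_lens c"
  by (simp add: flat_lens_def abs_square_le_1)

text \<open>Since the lens is horizontal, the slice of a L + b B_3 at height \<open>z\<close> is the
  planar body a L + t B_2.\<close>

lemma vec3_in_lens_parallel_iff: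
  fixes s c a b x y z :: real
  assumes "s > 0" "c > 0" "s\<^sup>2 + c\<^sup>2 = 1" "a \<ge> 0" "b \<ge> 0"
  defines "t \<equiv> sqrt (b\<^sup>2 - z\<^sup>2)"
  shows "vector [x, y, z] \<in> (*\<^sub>R) a ` flat_lens c + cball 0 b \<longleftrightarrow>
    \<bar>z\<bar> \<le> b \<and> \<bar>x\<bar> \<le> a * s + t \<and> \<bar>y\<bar> \<le> lens_height s c a t x"
proof -
  have "vector [x, y, z] \<in> (*\<^sub>R) a ` flat_lens c + cball 0 b \<longleftrightarrow>
      (\<exists>q\<in>flat_lens c. norm (vector [x, y, z] - a *\<^sub>R q) \<le> b)"
    (is "?p \<in> _ \<longleftrightarrow> _")
  proof
    assume "?p \<in> (*\<^sub>R) a ` flat_lens c + cball 0 b"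
    then obtain w v where w: "w \<in> (*\<^sub>R) a ` flat_lens c" and v: "v \<in> cball 0 b" and e: "?p = w + v"
      by (rule set_plus_elim)
    then obtain q where q: "q \<in> flat_lens c" "w = a *\<^sub>R q" by blast
    have "norm (?p - a *\<^sub>R q) \<le> b" unfolding e q(2) using v by simp
    then show "\<exists>q\<in>flat_lens c. norm (?p - a *\<^sub>R q) \<le> b" using q(1) by blast
  next
    assume "\<exists>q\<in>flat_lens c. norm (?p - a *\<^sub>R q) \<le> b"
    then obtain q where q: "q \<in> flat_lens c" "norm (?p - a *\<^sub>R q) \<le> b" by blast
    then have "a *\<^sub>R q + (?p - a *\<^sub>R q) \<in> (*\<^sub>R) a ` flat_lens c + cball 0 b"
      by (intro set_plus_intro) auto
    then show "?p \<in> (*\<^sub>R) a ` flat_lens c + cball 0 b" by simp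
  qed
  also have "\<dots> \<longleftrightarrow> (\<exists>q::real^3. q $ 3 = 0 \<and> (q $ 1)\<^sup>2 + (\<bar>q $ 2\<bar> + c)\<^sup>2 \<le> 1 \<and>
      (x - a * q $ 1)\<^sup>2 + (y - a * q $ 2)\<^sup>2 + z\<^sup>2 \<le> b\<^sup>2)"
    using \<open>b \<ge> 0\<close> by (auto simp: flat_lens_def norm_vec3_le_iff vector_3 Bex_def)
  also have "\<dots> \<longleftrightarrow> (\<exists>u v. u\<^sup>2 + (\<bar>v\<bar> + c)\<^sup>2 \<le> 1 \<and> (x - a * u)\<^sup>2 + (y - a * v)\<^sup>2 + z\<^sup>2 \<le> b\<^sup>2)"
  proof
    assume "\<exists>u v. u\<^sup>2 + (\<bar>v\<bar> + c)\<^sup>2 \<le> 1 \<and> (x - a * u)\<^sup>2 + (y - a * v)\<^sup>2 + z\<^sup>2 \<le> b\<^sup>2"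
    then obtain u v where "u\<^sup>2 + (\<bar>v\<bar> + c)\<^sup>2 \<le> 1" "(x - a * u)\<^sup>2 + (y - a * v)\<^sup>2 + z\<^sup>2 \<le> b\<^sup>2" by blast
    then show "\<exists>q::real^3. q $ 3 = 0 \<and> (q $ 1)\<^sup>2 + (\<bar>q $ 2\<bar> + c)\<^sup>2 \<le> 1 \<and>
      (x - a * q $ 1)\<^sup>2 + (y - a * q $ 2)\<^sup>2 + z\<^sup>2 \<le> b\<^sup>2"
      by (intro exI[of _ "vector [u, v, 0]"]) (simp add: vector_3)
  next
    assume "\<exists>q::real^3. q $ 3 = 0 \<and> (q $ 1)\<^sup>2 + (\<bar>q $ 2\<bar> + c)\<^sup>2 \<le> 1 \<and>
      (x - a * q $ 1)\<^sup>2 + (y - a * q $ 2)\<^sup>2 + z\<^sup>2 \<le> b\<^sup>2"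
    then obtain q :: "real ^ 3" where q: "(q $ 1)\<^sup>2 + (\<bar>q $ 2\<bar> + c)\<^sup>2 \<le> 1"
      "(x - a * q $ 1)\<^sup>2 + (y - a * q $ 2)\<^sup>2 + z\<^sup>2 \<le> b\<^sup>2" by blast
    show "\<exists>u v. u\<^sup>2 + (\<bar>v\<bar> + c)\<^sup>2 \<le> 1 \<and> (x - a * u)\<^sup>2 + (y - a * v)\<^sup>2 + z\<^sup>2 \<le> b\<^sup>2"
      by (rule exI[of _ "q $ 1"], rule exI[of _ "q $ 2"], rule conjI[OF q])
  qed
  \<comment> \<open>For \<open>\<bar>z\<bar> > b\<close> the slice is empty, yet \<open>t\<close> is
    then negative with positive square; the bound on \<open>z\<close> must therefore stand as its
    own conjunct.\<close>
  also have "\<dots> \<longleftrightarrow> \<bar>z\<bar> \<le> b \<and>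
      (\<exists>u v. u\<^sup>2 + (\<bar>v\<bar> + c)\<^sup>2 \<le> 1 \<and> (x - a * u)\<^sup>2 + (y - a * v)\<^sup>2 \<le> t\<^sup>2)"
  proof (cases "\<bar>z\<bar> \<le> b")
    case True
    then have "z\<^sup>2 \<le> b\<^sup>2" using power_mono[of "\<bar>z\<bar>" b 2] by simp
    then have "t\<^sup>2 = b\<^sup>2 - z\<^sup>2" by (simp add: t_def)
    then show ?thesis using True by (simp add: le_diff_eq)
  next
    case False
    then have "b\<^sup>2 < z\<^sup>2" using power_strict_mono[of b "\<bar>z\<bar>" 2] \<open>b \<ge> 0\<close> by simp
    then have "\<not> (x - a * u)\<^sup>2 + (y - a * v)\<^sup>2 + z\<^sup>2 \<le> b\<^sup>2" for u v
      using zero_le_power2[of "x - a * u"] zero_le_power2[of "y - a * v"] by linarith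
    then show ?thesis using False by blast
  qed
  also have "\<dots> \<longleftrightarrow> \<bar>z\<bar> \<le> b \<and> \<bar>x\<bar> \<le> a * s + t \<and> \<bar>y\<bar> \<le> lens_height s c a t x"
  proof (cases "\<bar>z\<bar> \<le> b")
    case True
    then have "z\<^sup>2 \<le> b\<^sup>2" using power_mono[of "\<bar>z\<bar>" b 2] by simp
    then show ?thesis using lens_parallel_iff[OF assms(1-4), of t x y] by (simp add: t_def)
  qed simp
  finally show ?thesis .
qed

text \<open>The slice area is quadratic in \<open>t = sqrt (b\<^sup>2 - z\<^sup>2)\<close>. Over
  \<open>{-b..b}\<close>, the powers 1, \<open>t\<close> and \<open>t\<^sup>2\<close> integrate to
  \<open>2 * b\<close>, the half-disc area \<open>pi * b\<^sup>2 / 2\<close> and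
  \<open>4 / 3 * b ^ 3\<close>.\<close>

lemma measure_lens_parallel:
  fixes a b \<theta> :: real
  assumes \<theta>: "0 < \<theta>" "\<theta> < pi / 2" and ab: "a \<ge> 0" "b \<ge> 0"
  shows "measure lebesgue ((*\<^sub>R) a ` flat_lens (cos \<theta>) + cball 0 b) =
    4 * a\<^sup>2 * b * (\<theta> - sin \<theta> * cos \<theta>) + 2 * pi * a * b\<^sup>2 * \<theta> + 4 / 3 * pi * b ^ 3"
    (is "measure _ ?S = ?V")
proof -
  define s c where "s = sin \<theta>" and "c = cos \<theta>"
  have s: "0 < s" and c: "0 < c" and sc: "s\<^sup>2 + c\<^sup>2 = 1"
    using \<theta> by (auto simp: s_def c_def sin_gt_zero2 cos_gt_zero)
  have "compact ?S"
    using c by (intro compact_set_plus compact_scaling compact_flat_lens compact_cball) (simp add: c_def)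
  then have S: "?S \<in> sets borel" by (simp add: borel_closed compact_imp_closed)
  define A where "A t = 2 * a\<^sup>2 * (\<theta> - sin \<theta> * cos \<theta>) + 4 * a * t * \<theta> + t\<^sup>2 * pi" for t
  \<comment> \<open>Ensures that areas and volume are nonnegative, as \<open>ennreal\<close>
    truncates negative values to 0.\<close>
  have "sin \<theta> * cos \<theta> \<le> \<theta>"
  proof -
    have "sin \<theta> * cos \<theta> \<le> sin \<theta>" using s s_def by (simp add: mult_left_le)
    also have "\<dots> \<le> \<theta>" using \<theta> by (simp add: sin_x_le_x)
    finally show ?thesis .
  qed
  then have A0: "A t \<ge> 0" if "t \<ge> 0" for t using that \<theta> ab by (simp add: A_def)
  have "emeasure lborel ?S = (\<integral>\<^sup>+z. ennreal (A (sqrt (b\<^sup>2 - z\<^sup>2))) * indicator {-b..b} z \<partial>lborel)"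
    unfolding emeasure_lborel_vec3[OF S]
  proof (rule nn_integral_cong)
    fix z :: real
    show "(\<integral>\<^sup>+x. emeasure lborel {y. vector [x, y, z] \<in> ?S} \<partial>lborel) =
        ennreal (A (sqrt (b\<^sup>2 - z\<^sup>2))) * indicator {-b..b} z"
    proof (cases "\<bar>z\<bar> \<le> b")
      case True
      then have "z\<^sup>2 \<le> b\<^sup>2" using power_mono[of "\<bar>z\<bar>" b 2] by simp
      then show ?thesis using True lens_parallel_area[OF \<theta> ab(1), of "sqrt (b\<^sup>2 - z\<^sup>2)"]
        unfolding vec3_in_lens_parallel_iff[OF s c sc ab, folded c_def] c_def[symmetric] s_def[symmetric]
        by (simp add: A_def c_def s_def abs_le_iff)
    next
      case False
      then show ?thesis
        unfolding vec3_in_lens_parallel_iff[OF s c sc ab] c_def[symmetric] by (auto simp: indicator_def)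
    qed
  qed
  also have "\<dots> = ennreal ?V"
  proof (rule nn_integral_has_integral_lebesgue')
    fix z assume "z \<in> {-b..b}"
    then have "z\<^sup>2 \<le> b\<^sup>2" using power_mono[of "\<bar>z\<bar>" b 2] by (auto simp: abs_le_iff)
    then show "0 \<le> A (sqrt (b\<^sup>2 - z\<^sup>2))" by (intro A0) simp
  next
    let ?k = "2 * a\<^sup>2 * (\<theta> - sin \<theta> * cos \<theta>)"
    have "((\<lambda>z. sqrt (b\<^sup>2 - (z - 0)\<^sup>2)) has_integral
        ((b - 0) * sqrt (b\<^sup>2 - (b - 0)\<^sup>2) + b\<^sup>2 * arcsin ((b - 0) / b)) / 2
        - ((- b - 0) * sqrt (b\<^sup>2 - (- b - 0)\<^sup>2) + b\<^sup>2 * arcsin ((- b - 0) / b)) / 2) {-b..b}"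
      using ab by (intro has_integral_circle) auto
    then have 1: "((\<lambda>z. sqrt (b\<^sup>2 - z\<^sup>2)) has_integral b\<^sup>2 * pi / 2) {-b..b}"
      by (cases "b = 0") (simp_all add: mult.commute)
    have 2: "((\<lambda>z. ?k + (b\<^sup>2 - z\<^sup>2) * pi) has_integral
        (?k * b + (b\<^sup>2 * b - b ^ 3 / 3) * pi) - (?k * (- b) + (b\<^sup>2 * (- b) - (- b) ^ 3 / 3) * pi)) {-b..b}"
      using ab
      by (intro fundamental_theorem_of_calculus_interior[where f = "\<lambda>z. ?k * z + (b\<^sup>2 * z - z ^ 3 / 3) * pi"])
         (auto intro!: derivative_eq_intros continuous_intros
            simp: has_real_derivative_iff_has_vector_derivative[symmetric] power2_eq_square)
    have "((\<lambda>z. 4 * a * \<theta> * sqrt (b\<^sup>2 - z\<^sup>2) + (?k + (b\<^sup>2 - z\<^sup>2) * pi)) has_integral ?V) {-b..b}"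
      using has_integral_add[OF has_integral_mult_right[OF 1, of "4 * a * \<theta>"] 2]
      by (rule back_subst[where P = "\<lambda>i. (_ has_integral i) _"])
         (simp add: algebra_simps power2_eq_square power3_eq_cube)
    then show "((\<lambda>z. A (sqrt (b\<^sup>2 - z\<^sup>2))) has_integral ?V) {-b..b}"
    proof (rule has_integral_eq[rotated])
      fix z assume "z \<in> {-b..b}"
      then have "z\<^sup>2 \<le> b\<^sup>2" using power_mono[of "\<bar>z\<bar>" b 2] by (auto simp: abs_le_iff)
      then show "4 * a * \<theta> * sqrt (b\<^sup>2 - z\<^sup>2) + (?k + (b\<^sup>2 - z\<^sup>2) * pi) = A (sqrt (b\<^sup>2 - z\<^sup>2))"
        by (simp add: A_def)
    qed
  qed
  finally have e: "emeasure lborel ?S = ennreal ?V" .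
  have "?V \<ge> 0" using \<open>sin \<theta> * cos \<theta> \<le> \<theta>\<close> ab \<theta> by simp
  then show ?thesis using e S by (simp add: measure_def)
qed

subsection \<open>The Steiner polynomial and its roots\<close>

lemma norm_flat_lens_le:
  assumes "s > 0" "c > 0" and sc: "s\<^sup>2 + c\<^sup>2 = 1" and q: "q \<in> flat_lens c"
  shows "norm q \<le> s"
proof -
  have q': "q $ 3 = 0" "(q $ 1)\<^sup>2 + (\<bar>q $ 2\<bar> + c)\<^sup>2 \<le> 1" using q by (auto simp: flat_lens_def)
  have "(\<bar>q $ 2\<bar> + c)\<^sup>2 = (q $ 2)\<^sup>2 + c\<^sup>2 + 2 * \<bar>q $ 2\<bar> * c" by (simp add: power2_sum)
  moreover have "0 \<le> 2 * \<bar>q $ 2\<bar> * c" using \<open>c > 0\<close> by simp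
  ultimately have "(q $ 1)\<^sup>2 + (q $ 2)\<^sup>2 \<le> s\<^sup>2" using q'(2) sc by linarith
  then show ?thesis using \<open>s > 0\<close> q'(1) by (simp add: norm_vec3_le_iff)
qed

text \<open>The body lies in the ball of radius \<open>1 + s\<close> about 0 and contains two
  antipodal points of its boundary. Scaled by \<open>r\<close> and translated, these are
  \<open>2 * \<bar>r\<bar> * (1 + s)\<close> apart, which cannot exceed the diameter 2 of the unit
  ball.\<close>

lemma relative_inradius_lens:
  assumes s: "s > 0" and c: "c > 0" and sc: "s\<^sup>2 + c\<^sup>2 = 1"
  shows "relative_inradius (cball 0 1) (flat_lens c + cball 0 1) = 1 / (1 + s)"
  unfolding relative_inradius_def
proof (rule Greatest_equality)
  have "norm ((1 / (1 + s)) *\<^sub>R p) \<le> 1" if "p \<in> flat_lens c + cball 0 1" for p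
  proof -
    from that obtain q v where q: "q \<in> flat_lens c" and v: "v \<in> cball 0 1" and p: "p = q + v"
      by (rule set_plus_elim)
    have "norm p \<le> norm q + norm v" unfolding p by (rule norm_triangle_ineq)
    also have "\<dots> \<le> s + 1" using norm_flat_lens_le[OF assms q] v by simp
    finally show ?thesis using s by simp
  qed
  then show "\<exists>x. (\<lambda>y. x + (1 / (1 + s)) *\<^sub>R y) ` (flat_lens c + cball 0 1) \<subseteq> cball 0 1"
    by (intro exI[of _ 0]) auto
next
  fix r assume "\<exists>x. (\<lambda>y. x + r *\<^sub>R y) ` (flat_lens c + cball 0 1) \<subseteq> cball 0 1"
  then obtain x where x: "\<And>y. y \<in> flat_lens c + cball 0 1 \<Longrightarrow> norm (x + r *\<^sub>R y) \<le> 1"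
    by (auto simp: image_subset_iff)
  let ?e = "axis 1 1 :: real ^ 3"
  have e: "?e $ 2 = 0" "?e $ 3 = 0" by (auto simp: axis_def)
  have "s *\<^sub>R ?e \<in> flat_lens c" "(- s) *\<^sub>R ?e \<in> flat_lens c"
    using sc c by (auto simp: flat_lens_def e)
  moreover have "?e \<in> cball 0 1" "- ?e \<in> cball 0 1" by (simp_all add: norm_axis_1)
  ultimately have "s *\<^sub>R ?e + ?e \<in> flat_lens c + cball 0 1" "(- s) *\<^sub>R ?e + - ?e \<in> flat_lens c + cball 0 1"
    by (blast intro: set_plus_intro)+
  then have "norm (x + r *\<^sub>R (s *\<^sub>R ?e + ?e)) \<le> 1" "norm (x + r *\<^sub>R ((- s) *\<^sub>R ?e + - ?e)) \<le> 1"
    by (auto intro: x)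
  then have "norm ((x + r *\<^sub>R (s *\<^sub>R ?e + ?e)) - (x + r *\<^sub>R ((- s) *\<^sub>R ?e + - ?e))) \<le> 2"
    using norm_triangle_ineq4[of "x + r *\<^sub>R (s *\<^sub>R ?e + ?e)" "x + r *\<^sub>R ((- s) *\<^sub>R ?e + - ?e)"] by linarith
  moreover have "(x + r *\<^sub>R (s *\<^sub>R ?e + ?e)) - (x + r *\<^sub>R ((- s) *\<^sub>R ?e + - ?e)) = (2 * r * (1 + s)) *\<^sub>R ?e"
    by (simp add: vec_eq_iff algebra_simps)
  ultimately have "\<bar>2 * r * (1 + s)\<bar> \<le> 2" by (simp add: norm_axis_1)
  then have "r * (1 + s) \<le> 1" by linarith
  then show "r \<le> 1 / (1 + s)" using s by (simp add: pos_le_divide_eq)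
qed

section \<open>The Steiner polynomial\<close>

lemma cball_plus_scaled_lens:
  assumes "\<rho> \<ge> 0"
  shows "cball 0 1 + (*\<^sub>R) \<rho> ` (flat_lens c + cball 0 1) = (*\<^sub>R) \<rho> ` flat_lens c + cball 0 (1 + \<rho>)"
proof (intro equalityI subsetI)
  fix p assume "p \<in> cball 0 1 + (*\<^sub>R) \<rho> ` (flat_lens c + cball 0 1)"
  then obtain w q v where w: "norm w \<le> 1" and q: "q \<in> flat_lens c" and v: "norm v \<le> 1"
    and p: "p = \<rho> *\<^sub>R q + (w + \<rho> *\<^sub>R v)"
    by (auto elim!: set_plus_elim simp: algebra_simps)
  have "norm (w + \<rho> *\<^sub>R v) \<le> norm w + \<rho> * norm v"
    using norm_triangle_ineq[of w "\<rho> *\<^sub>R v"] assms by simp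
  also have "\<dots> \<le> 1 + \<rho>" using w mult_left_le[OF v assms] by linarith
  finally show "p \<in> (*\<^sub>R) \<rho> ` flat_lens c + cball 0 (1 + \<rho>)"
    unfolding p using q by (intro set_plus_intro) auto
next
  fix p assume "p \<in> (*\<^sub>R) \<rho> ` flat_lens c + cball 0 (1 + \<rho>)"
  then obtain q d where q: "q \<in> flat_lens c" and d: "norm d \<le> 1 + \<rho>" and p: "p = \<rho> *\<^sub>R q + d"
    by (auto elim!: set_plus_elim)
  \<comment> \<open>The same \<open>v\<close> serves in both unit balls, because \<open>d\<close>
    splits as \<open>v\<close> plus \<open>\<rho>\<close> times \<open>v\<close>.\<close>
  define v where "v = (1 / (1 + \<rho>)) *\<^sub>R d"
  have v: "norm v \<le> 1" using d assms by (simp add: v_def)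
  have "d = (1 + \<rho>) *\<^sub>R v" using assms by (simp add: v_def)
  then have "p = v + \<rho> *\<^sub>R (q + v)" by (simp add: p algebra_simps)
  then show "p \<in> cball 0 1 + (*\<^sub>R) \<rho> ` (flat_lens c + cball 0 1)"
    using q v by (auto intro!: set_plus_intro imageI)
qed

text \<open>The volume is a polynomial in \<open>\<rho>\<close>, so uniqueness of the expansion
  identifies the quermassintegrals. Each of its three terms contains \<open>1 + \<rho>\<close>,
  which leaves a quadratic factor.\<close>

lemma poly_steiner_poly_lens:
  fixes \<theta> :: real and s :: complex
  assumes \<theta>: "0 < \<theta>" "\<theta> < pi / 2"
  defines "M \<equiv> 2 * pi * \<theta>" and "\<sigma> \<equiv> 4 * (\<theta> - sin \<theta> * cos \<theta>)" and "\<kappa> \<equiv> 4 / 3 * pi"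
  shows "poly (steiner_poly (cball 0 1) (flat_lens (cos \<theta>) + cball 0 1)) s =
    (1 + s) * (of_real (\<sigma> + M + \<kappa>) * s\<^sup>2 + of_real (M + 2 * \<kappa>) * s + of_real \<kappa>)"
proof -
  let ?K = "flat_lens (cos \<theta>) + cball 0 1"
  \<comment> \<open>Coefficients of the expanded volume, divided by the binomials 1, 3, 3,
    1.\<close>
  define W where "W i = (if i = 0 then \<kappa> else if i = 1 then (M + 3 * \<kappa>) / 3
      else if i = 2 then (\<sigma> + 2 * M + 3 * \<kappa>) / 3 else \<sigma> + M + \<kappa>)" for i :: nat
  have three: "{..3} = {0, 1, 2, 3 :: nat}" by auto
  have choose: "(3 choose 2 :: nat) = 3" "(3 choose 3 :: nat) = 1" "(3 choose 1 :: nat) = 3"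
    by (simp_all add: eval_nat_numeral)
  have W: "is_steiner_expansion (cball 0 1) ?K W"
    unfolding is_steiner_expansion_def
  proof (intro allI impI)
    fix \<rho> :: real assume "\<rho> \<ge> 0"
    then have "measure lebesgue (cball 0 1 + (*\<^sub>R) \<rho> ` ?K) =
        4 * \<rho>\<^sup>2 * (1 + \<rho>) * (\<theta> - sin \<theta> * cos \<theta>) + 2 * pi * \<rho> * (1 + \<rho>)\<^sup>2 * \<theta> + 4 / 3 * pi * (1 + \<rho>) ^ 3"
      using measure_lens_parallel[OF \<theta>, of \<rho> "1 + \<rho>"] by (simp add: cball_plus_scaled_lens)
    also have "\<dots> = \<sigma> * \<rho>\<^sup>2 * (1 + \<rho>) + M * \<rho> * (1 + \<rho>)\<^sup>2 + \<kappa> * (1 + \<rho>) ^ 3"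
      by (simp add: \<sigma>_def M_def \<kappa>_def)
    also have "\<dots> = (\<Sum>i\<le>DIM(real ^ 3). real (DIM(real ^ 3) choose i) * W i * \<rho> ^ i)"
      by (simp add: three choose W_def power2_eq_square power3_eq_cube field_simps)
    finally show "measure lebesgue (cball 0 1 + (*\<^sub>R) \<rho> ` ?K) =
        (\<Sum>i\<le>DIM(real ^ 3). real (DIM(real ^ 3) choose i) * W i * \<rho> ^ i)" .
  qed
  have "poly (steiner_poly (cball 0 1) ?K) s =
      (\<Sum>i\<le>DIM(real ^ 3). of_nat (DIM(real ^ 3) choose i) * of_real (W i) * s ^ i)"
    unfolding steiner_poly_def poly_sum poly_monom
    by (intro sum.cong refl) (simp add: quermassintegral_eqI[OF W])
  also have "\<dots> = (1 + s) * (of_real (\<sigma> + M + \<kappa>) * s\<^sup>2 + of_real (M + 2 * \<kappa>) * s + of_real \<kappa>)"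
    by (simp add: three choose W_def power2_eq_square power3_eq_cube field_simps)
  finally show ?thesis .
qed

section \<open>Location of the roots\<close>

text \<open>Hurwitz criterion in degree two: the hypotheses say that the quadratic in the shifted
  variable \<open>s + r\<close> has positive coefficients. If \<open>Re s \<ge> - r\<close>, the
  imaginary part forces \<open>s\<close> to be real, and then the value is positive.\<close>

lemma quadratic_root_Re_less:
  fixes \<alpha> \<beta> \<gamma> r :: real and s :: complex
  assumes \<alpha>: "\<alpha> > 0" and \<beta>: "\<beta> - 2 * \<alpha> * r > 0" and \<gamma>: "\<gamma> - \<beta> * r + \<alpha> * r\<^sup>2 > 0"
    and root: "of_real \<alpha> * s\<^sup>2 + of_real \<beta> * s + of_real \<gamma> = 0"
  shows "Re s < - r"
proof (rule ccontr)
  assume "\<not> Re s < - r"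
  define w where "w = Re s + r"
  have w: "w \<ge> 0" using \<open>\<not> Re s < - r\<close> by (simp add: w_def)
  have x: "Re s = w - r" by (simp add: w_def)
  have "Im (of_real \<alpha> * s\<^sup>2 + of_real \<beta> * s + of_real \<gamma>) = Im s * (2 * (\<alpha> * w) + (\<beta> - 2 * \<alpha> * r))"
    by (simp add: power2_eq_square x algebra_simps)
  moreover have "2 * (\<alpha> * w) + (\<beta> - 2 * \<alpha> * r) > 0" using \<alpha> \<beta> w by (simp add: add_nonneg_pos)
  ultimately have "Im s = 0" using root by simp
  then have "Re (of_real \<alpha> * s\<^sup>2 + of_real \<beta> * s + of_real \<gamma>)
      = \<alpha> * w\<^sup>2 + (\<beta> - 2 * \<alpha> * r) * w + (\<gamma> - \<beta> * r + \<alpha> * r\<^sup>2)"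
    by (simp add: power2_eq_square x algebra_simps)
  also have "\<dots> > 0"
  proof -
    have "0 \<le> \<alpha> * w\<^sup>2" "0 \<le> (\<beta> - 2 * \<alpha> * r) * w" using \<alpha> \<beta> w by simp_all
    then show ?thesis using \<gamma> by linarith
  qed
  finally show False using root by simp
qed

text \<open>The angle is complementary to \<open>pi / 8\<close>, whose double has known sine and
  cosine.\<close>

lemma sin_cos_3pi8:
  shows "(sin (3 * pi / 8))\<^sup>2 = (2 + sqrt 2) / 4" "sin (3 * pi / 8) * cos (3 * pi / 8) = sqrt 2 / 4"
proof -
  have a: "pi / 2 - 3 * pi / 8 = pi / 8" by simp
  have s: "sin (3 * pi / 8) = cos (pi / 8)" "cos (3 * pi / 8) = sin (pi / 8)"
    using sin_cos_eq[of "3 * pi / 8"] cos_sin_eq[of "3 * pi / 8"] unfolding a by auto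
  have "cos (pi / 4) = 2 * (cos (pi / 8))\<^sup>2 - 1" using cos_double_cos[of "pi / 8"] by simp
  then show "(sin (3 * pi / 8))\<^sup>2 = (2 + sqrt 2) / 4" unfolding s cos_45 by (simp add: field_simps)
  have "sin (pi / 4) = 2 * sin (pi / 8) * cos (pi / 8)" using sin_double[of "pi / 8"] by simp
  then show "sin (3 * pi / 8) * cos (3 * pi / 8) = sqrt 2 / 4" unfolding s sin_45 by simp
qed

theorem corollary1p1:
  "\<exists>K :: (real ^ 3) set. convex_body K \<and> interior K \<noteq> {} \<and>
     (\<forall>s::complex. poly (steiner_poly (cball 0 1) K) s = 0 \<longrightarrow>
        Re s < - relative_inradius (cball 0 1) K)"
proof (intro exI conjI allI impI)
  define \<theta> S c where "\<theta> = 3 * pi / 8" and "S = sin \<theta>" and "c = cos \<theta>"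
  have \<theta>: "0 < \<theta>" "\<theta> < pi / 2" by (auto simp: \<theta>_def)
  have S: "S > 0" and c: "c > 0" and sc: "S\<^sup>2 + c\<^sup>2 = 1"
    using \<theta> by (auto simp: S_def c_def sin_gt_zero2 cos_gt_zero)
  let ?K = "flat_lens c + cball 0 1"
  show "convex_body ?K"
    using c by (auto simp: convex_body_def intro!: compact_set_plus convex_set_plus compact_flat_lens convex_flat_lens)
  have "c \<le> 1" by (simp add: c_def)
  then have "0 + v \<in> ?K" if "v \<in> cball 0 1" for v
    using that c by (intro set_plus_intro zero_in_flat_lens) auto
  then have "ball 0 1 \<subseteq> ?K" by auto
  then have "ball 0 1 \<subseteq> interior ?K" by (intro interior_maximal) auto
  then show "interior ?K \<noteq> {}" by force
  fix s :: complex
  assume root: "poly (steiner_poly (cball 0 1) ?K) s = 0"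
  define M \<sigma> \<kappa> where "M = 2 * pi * \<theta>" and "\<sigma> = 4 * (\<theta> - sin \<theta> * cos \<theta>)" and "\<kappa> = 4 / 3 * pi"
  define r where "r = 1 / (1 + S)"
  have r: "0 < r" "r < 1" "r * (1 + S) = 1" using S by (auto simp: r_def)
  \<comment> \<open>The quantity in fact \<open>1\<close> below is only about 0.03, so the bounds
    for \<open>pi\<close>, \<open>sqrt 2\<close> and \<open>S\<close> must be accurate to about
    three decimals.\<close>
  have pi: "157 / 50 < pi" "pi < 1571 / 500" using pi_approx by auto
  have sq2: "7071 / 5000 < sqrt 2" "sqrt 2 < 70711 / 50000"
    by (rule real_less_rsqrt, simp add: power2_eq_square) (rule real_less_lsqrt; simp add: power2_eq_square)
  have S2: "S\<^sup>2 = (2 + sqrt 2) / 4" and SC: "sin \<theta> * cos \<theta> = sqrt 2 / 4"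
    using sin_cos_3pi8 by (auto simp: S_def \<theta>_def)
  have "S\<^sup>2 < (231 / 250)\<^sup>2" "(4619 / 5000)\<^sup>2 < S\<^sup>2" unfolding S2 using sq2 by (auto simp: power2_eq_square)
  then have Sb: "S < 231 / 250" "4619 / 5000 < S"
    using S by (auto dest: power_less_imp_less_base)
  have M: "M = 3 / 4 * pi\<^sup>2" and \<sigma>: "\<sigma> = 3 / 2 * pi - sqrt 2"
    using SC by (auto simp: M_def \<sigma>_def \<theta>_def power2_eq_square)
  \<comment> \<open>Bounding \<open>pi\<^sup>2\<close> by multiples of \<open>pi\<close> makes the
    remaining estimates linear.\<close>
  have pi2: "157 / 50 * pi < pi\<^sup>2" "pi\<^sup>2 < 1571 / 500 * pi" using pi by (auto simp: power2_eq_square)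
  have "M > 0" "\<sigma> > 0" "\<kappa> > 0" using pi sq2 by (auto simp: M \<sigma> \<kappa>_def)
  have "M * S < M * (231 / 250)" using \<open>M > 0\<close> Sb by simp
  \<comment> \<open>The constant lies just below \<open>(2 + 7071 / 5000) / 4\<close>, the lower
    bound for \<open>S\<^sup>2\<close>.\<close>
  moreover have "\<kappa> * (1707 / 2000) < \<kappa> * S\<^sup>2" unfolding S2 using \<open>\<kappa> > 0\<close> sq2 by simp
  ultimately have 1: "\<kappa> * S\<^sup>2 - M * S + \<sigma> > 0"
    using pi pi2 sq2 M \<sigma> \<kappa>_def by linarith
  have "M * (4619 / 5000) < M * S" "\<kappa> * (4619 / 5000) < \<kappa> * S" using \<open>M > 0\<close> \<open>\<kappa> > 0\<close> Sb by auto
  then have 2: "(M + 2 * \<kappa>) * (1 + S) - 2 * (\<sigma> + M + \<kappa>) > 0"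
    using pi pi2 sq2 M \<sigma> \<kappa>_def unfolding distrib_left distrib_right by linarith
  have "s = - 1 \<or> of_real (\<sigma> + M + \<kappa>) * s\<^sup>2 + of_real (M + 2 * \<kappa>) * s + of_real \<kappa> = 0"
    using root unfolding c_def poly_steiner_poly_lens[OF \<theta>, folded M_def \<sigma>_def \<kappa>_def] mult_eq_0_iff
    by (auto simp: add_eq_0_iff)
  then have "Re s < - r"
  proof
    assume "s = - 1"
    then show ?thesis using r by simp
  next
    assume "of_real (\<sigma> + M + \<kappa>) * s\<^sup>2 + of_real (M + 2 * \<kappa>) * s + of_real \<kappa> = 0"
    then show ?thesis
    proof (rule quadratic_root_Re_less[rotated 3])
      show "\<sigma> + M + \<kappa> > 0" using \<open>M > 0\<close> \<open>\<sigma> > 0\<close> \<open>\<kappa> > 0\<close> by simp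
      \<comment> \<open>As \<open>r * (1 + S) = 1\<close>, the lower coefficients of the shifted
        quadratic are \<open>r\<close> times the quantity in fact \<open>2\<close> and
        \<open>r\<^sup>2\<close> times that in fact \<open>1\<close>.\<close>
      have "(M + 2 * \<kappa>) - 2 * (\<sigma> + M + \<kappa>) * r = r * ((M + 2 * \<kappa>) * (1 + S) - 2 * (\<sigma> + M + \<kappa>))"
        using r(3) by algebra
      then show "(M + 2 * \<kappa>) - 2 * (\<sigma> + M + \<kappa>) * r > 0" using 2 r by simp
      have "\<kappa> - (M + 2 * \<kappa>) * r + (\<sigma> + M + \<kappa>) * r\<^sup>2 = r\<^sup>2 * (\<kappa> * S\<^sup>2 - M * S + \<sigma>)"
        using r(3) by algebra
      then show "\<kappa> - (M + 2 * \<kappa>) * r + (\<sigma> + M + \<kappa>) * r\<^sup>2 > 0" using 1 r by simp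
    qed
  qed
  then show "Re s < - relative_inradius (cball 0 1) ?K"
    using relative_inradius_lens[OF S c sc] by (simp add: r_def)
qed

end
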